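(* Let $(T,X)$ be a minimal flow on a nonempty compact Hausdorff space $X$. Then $(T,X)$ is an a.a. flow if and only if there exists a point $x\in X$ such that $Q[x]=\{x\}$.
   Context: $T$ is a topological semigroup with identity $e$. A semiflow $(T,X)$ is a jointly continuous map $T\times X\to X$, $(t,x)\mapsto tx$, with $ex=x$ and $t(sx)=(ts)x$; it is a flow if $T$ is a group. It is minimal if every orbit $Tx$ is dense in $X$. A point $x\in X$ is almost automorphic, written $x\in P_{aa}(T,X)$, if for every net $\{t_n\}$ in $T$ and net $\{x_n'\}$ in $X$: $t_nx\to y$, $x_n'\to x'$ and $t_nx_n'=y$ for all $n$ imply $x=x'$. $(T,X)$ is an a.a. flow if it is a flow and there is $x\in P_{aa}(T,X)$ with dense orbit. Regional proximality: $x'\in Q[x]$ (equivalently $(x,x')\in Q(T,X)=Q(X)$) if there are nets $\{x_n\},\{x_n'\}$ in $X$ and $\{t_n\}$ in $T$ with $x_n\to x$, $x_n'\to x'$ and $\lim_n t_nx_n=\lim_n t_nx_n'$. *)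

theory Defs
  imports "HOL-Analysis.Analysis"
begin

section \<open>Nets\<close>

definition directed_set :: "'i set \<Rightarrow> ('i \<Rightarrow> 'i \<Rightarrow> bool) \<Rightarrow> bool" where
  "directed_set D le \<longleftrightarrow> D \<noteq> {} \<and> (\<forall>i\<in>D. le i i)
     \<and> (\<forall>i\<in>D. \<forall>j\<in>D. \<forall>k\<in>D. le i j \<longrightarrow> le j k \<longrightarrow> le i k)
     \<and> (\<forall>i\<in>D. \<forall>j\<in>D. \<exists>k\<in>D. le i k \<and> le j k)"

text \<open>The filter of tails of a directed set; a net \<open>f\<close> indexed by \<open>D\<close> converges to \<open>l\<close>
  iff \<open>(f \<longlongrightarrow> l) (net_filter D le)\<close>, see \<open>tendsto_net_filter_iff\<close> below.\<close>

definition net_filter :: "'i set \<Rightarrow> ('i \<Rightarrow> 'i \<Rightarrow> bool) \<Rightarrow> 'i filter" where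
  "net_filter D le = (INF i\<in>D. principal {j\<in>D. le i j})"

lemma directed_setD:
  assumes "directed_set D le"
  shows "D \<noteq> {}" "i \<in> D \<Longrightarrow> le i i"
    "i \<in> D \<Longrightarrow> j \<in> D \<Longrightarrow> k \<in> D \<Longrightarrow> le i j \<Longrightarrow> le j k \<Longrightarrow> le i k"
    "i \<in> D \<Longrightarrow> j \<in> D \<Longrightarrow> \<exists>k\<in>D. le i k \<and> le j k"
  using assms unfolding directed_set_def by metis+

lemma eventually_net_filter:
  assumes D: "directed_set D le"
  shows "eventually P (net_filter D le) \<longleftrightarrow> (\<exists>i\<in>D. \<forall>j\<in>D. le i j \<longrightarrow> P j)"
proof -
  have "\<exists>k\<in>D. principal {j \<in> D. le k j} \<le> inf (principal {j \<in> D. le a j}) (principal {j \<in> D. le b j})"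
    if ab: "a \<in> D" "b \<in> D" for a b
  proof -
    from directed_setD(4)[OF D ab] obtain k where k: "k \<in> D" "le a k" "le b k" by auto
    have "{j \<in> D. le k j} \<subseteq> {j \<in> D. le a j} \<inter> {j \<in> D. le b j}"
      using directed_setD(3)[OF D ab(1) k(1) _ k(2)] directed_setD(3)[OF D ab(2) k(1) _ k(3)]
      by auto
    then show ?thesis using k(1) by (intro bexI[of _ k]) simp_all
  qed
  then have "eventually P (net_filter D le) \<longleftrightarrow> (\<exists>i\<in>D. eventually P (principal {j \<in> D. le i j}))"
    unfolding net_filter_def by (intro eventually_INF_base directed_setD(1)[OF D])
  then show ?thesis by (auto simp: eventually_principal)
qed

lemma tendsto_net_filter_iff:
  assumes "directed_set D le"
  shows "(f \<longlongrightarrow> l) (net_filter D le) \<longleftrightarrow>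
    (\<forall>U. open U \<longrightarrow> l \<in> U \<longrightarrow> (\<exists>i\<in>D. \<forall>j\<in>D. le i j \<longrightarrow> f j \<in> U))"
  by (simp add: tendsto_def eventually_net_filter[OF assms])

text \<open>HOL cannot quantify over index types inside a definition.  Nets in a type \<open>'p\<close> are
  therefore indexed by directed sets of subsets of \<open>'p\<close> (with an arbitrary preorder).  This loses
  no nets: any net in \<open>'p\<close>, whatever its index type, can be replaced by one of this kind whose
  values are values of the given net and which is eventually in every set that the given net is
  eventually in.\<close>

lemma net_reindex:
  fixes f :: "'i \<Rightarrow> 'p"
  assumes "directed_set D le"
  obtains D' le' and g :: "'p set \<Rightarrow> 'p"
  where "directed_set D' le'" "g ` D' \<subseteq> f ` D"
    "filtermap g (net_filter D' le') \<le> filtermap f (net_filter D le)"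
proof -
  define tl where "tl i = f ` {j\<in>D. le i j}" for i
  define g where "g A = (SOME p. p \<in> A)" for A :: "'p set"
  let ?le = "\<lambda>A B :: 'p set. B \<subseteq> A"
  have refl: "le i i" if "i \<in> D" for i using directed_setD(2)[OF assms that] .
  have g: "g (tl i) \<in> tl i" if "i \<in> D" for i
    unfolding g_def by (rule someI[of _ "f i"]) (use that refl in \<open>auto simp: tl_def\<close>)
  have dir: "directed_set (tl ` D) ?le"
    unfolding directed_set_def
  proof (intro conjI ballI)
    show "tl ` D \<noteq> {}" using assms by (simp add: directed_set_def)
    fix A B assume "A \<in> tl ` D" "B \<in> tl ` D"
    then obtain a b where ab: "a \<in> D" "b \<in> D" "A = tl a" "B = tl b" by auto
    from directed_setD(4)[OF assms ab(1,2)] obtain k where k: "k \<in> D" "le a k" "le b k" by auto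
    have "le a j" "le b j" if "j \<in> D" "le k j" for j
      using directed_setD(3)[OF assms ab(1) k(1) that(1) k(2) that(2)]
        directed_setD(3)[OF assms ab(2) k(1) that(1) k(3) that(2)] by simp_all
    then have "tl k \<subseteq> A" "tl k \<subseteq> B" by (auto simp: ab tl_def)
    then show "\<exists>C\<in>tl ` D. C \<subseteq> A \<and> C \<subseteq> B" using k by auto
  qed auto
  have "g ` tl ` D \<subseteq> f ` D" using g by (fastforce simp: tl_def)
  moreover have "filtermap g (net_filter (tl ` D) ?le) \<le> filtermap f (net_filter D le)"
  proof (rule filter_leI)
    fix P assume "eventually P (filtermap f (net_filter D le))"
    then obtain i where i: "i \<in> D" "\<forall>j\<in>D. le i j \<longrightarrow> P (f j)"
      by (auto simp: eventually_filtermap eventually_net_filter[OF assms])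
    then have "\<forall>p\<in>tl i. P p" by (auto simp: tl_def)
    then show "eventually P (filtermap g (net_filter (tl ` D) ?le))"
      using g i(1) by (fastforce simp: eventually_filtermap eventually_net_filter[OF dir])
  qed
  ultimately show thesis by (rule that[OF dir])
qed

section \<open>Semiflows\<close>

definition semiflow :: "('t::topological_monoid_mult \<Rightarrow> 'x::topological_space \<Rightarrow> 'x) \<Rightarrow> bool" where
  "semiflow act \<longleftrightarrow> continuous_on UNIV (\<lambda>(t, x). act t x)
     \<and> (\<forall>x. act 1 x = x) \<and> (\<forall>t s x. act t (act s x) = act (t * s) x)"

text \<open>The phase semigroup is a group algebraically; its inversion need not be continuous.\<close>

definition flow :: "('t::topological_monoid_mult \<Rightarrow> 'x::topological_space \<Rightarrow> 'x) \<Rightarrow> bool" where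
  "flow act \<longleftrightarrow> semiflow act \<and> (\<forall>t::'t. \<exists>s. s * t = 1 \<and> t * s = 1)"

definition orbit :: "('t \<Rightarrow> 'x \<Rightarrow> 'x) \<Rightarrow> 'x \<Rightarrow> 'x set" where
  "orbit act x = range (\<lambda>t. act t x)"

definition minimal :: "('t \<Rightarrow> 'x::topological_space \<Rightarrow> 'x) \<Rightarrow> bool" where
  "minimal act \<longleftrightarrow> (\<forall>x. closure (orbit act x) = UNIV)"

text \<open>A pair of nets \<open>t\<^sub>n\<close>, \<open>x'\<^sub>n\<close> on a common directed set is a net in \<open>'t \<times> 'x\<close>.\<close>

definition almost_automorphic_points :: "('t \<Rightarrow> 'x::topological_space \<Rightarrow> 'x) \<Rightarrow> 'x set" where
  "almost_automorphic_points act =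
    {x. \<forall>(D :: ('t \<times> 'x) set set) le t x'n x' y.
        directed_set D le \<longrightarrow>
        ((\<lambda>n. act (t n) x) \<longlongrightarrow> y) (net_filter D le) \<longrightarrow>
        (x'n \<longlongrightarrow> x') (net_filter D le) \<longrightarrow>
        (\<forall>n\<in>D. act (t n) (x'n n) = y) \<longrightarrow> x = x'}"

definition aa_flow :: "('t::topological_monoid_mult \<Rightarrow> 'x::topological_space \<Rightarrow> 'x) \<Rightarrow> bool" where
  "aa_flow act \<longleftrightarrow> flow act
     \<and> (\<exists>x \<in> almost_automorphic_points act. closure (orbit act x) = UNIV)"

definition regionally_proximal :: "('t \<Rightarrow> 'x::topological_space \<Rightarrow> 'x) \<Rightarrow> ('x \<times> 'x) set" where
  "regionally_proximal act =
    {(x, x'). \<exists>(D :: ('t \<times> 'x \<times> 'x) set set) le t xn x'n z.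
        directed_set D le \<and>
        (xn \<longlongrightarrow> x) (net_filter D le) \<and>
        (x'n \<longlongrightarrow> x') (net_filter D le) \<and>
        ((\<lambda>n. act (t n) (xn n)) \<longlongrightarrow> z) (net_filter D le) \<and>
        ((\<lambda>n. act (t n) (x'n n)) \<longlongrightarrow> z) (net_filter D le)}"

text \<open>Both notions are independent of the index type chosen in their definitions.\<close>

lemma almost_automorphic_pointsD:
  fixes act :: "'t \<Rightarrow> 'x::topological_space \<Rightarrow> 'x" and D :: "'i set"
  assumes "x \<in> almost_automorphic_points act" and D: "directed_set D le"
    and y: "((\<lambda>n. act (t n) x) \<longlongrightarrow> y) (net_filter D le)"
    and x': "(x'n \<longlongrightarrow> x') (net_filter D le)"
    and eq: "\<forall>n\<in>D. act (t n) (x'n n) = y"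
  shows "x = x'"
proof -
  let ?f = "\<lambda>n. (t n, x'n n)"
  obtain D' le' and g :: "('t \<times> 'x) set \<Rightarrow> 't \<times> 'x"
    where D': "directed_set D' le'" and img: "g ` D' \<subseteq> ?f ` D"
      and le: "filtermap g (net_filter D' le') \<le> filtermap ?f (net_filter D le)"
    by (rule net_reindex[OF D])
  have lim: "((\<lambda>n. h (g n)) \<longlongrightarrow> l) (net_filter D' le')"
    if "((\<lambda>n. h (?f n)) \<longlongrightarrow> l) (net_filter D le)" for h :: "'t \<times> 'x \<Rightarrow> 'x" and l
    using tendsto_mono[OF le, of h l] that by (simp add: filterlim_filtermap)
  have "((\<lambda>n. act (fst (g n)) x) \<longlongrightarrow> y) (net_filter D' le')"
    by (rule lim) (use y in simp)
  moreover have "((\<lambda>n. snd (g n)) \<longlongrightarrow> x') (net_filter D' le')"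
    by (rule lim) (use x' in simp)
  moreover have "\<forall>n\<in>D'. act (fst (g n)) (snd (g n)) = y"
  proof
    fix n assume "n \<in> D'"
    then obtain i where "i \<in> D" "g n = ?f i" using img by blast
    then show "act (fst (g n)) (snd (g n)) = y" using eq by simp
  qed
  ultimately show ?thesis
    using assms(1)[unfolded almost_automorphic_points_def mem_Collect_eq, rule_format, OF D'] by simp
qed

lemma regionally_proximalI:
  fixes act :: "'t \<Rightarrow> 'x::topological_space \<Rightarrow> 'x" and D :: "'i set"
  assumes D: "directed_set D le"
    and x: "(xn \<longlongrightarrow> x) (net_filter D le)"
    and x': "(x'n \<longlongrightarrow> x') (net_filter D le)"
    and z: "((\<lambda>n. act (t n) (xn n)) \<longlongrightarrow> z) (net_filter D le)"
    and z': "((\<lambda>n. act (t n) (x'n n)) \<longlongrightarrow> z) (net_filter D le)"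
  shows "(x, x') \<in> regionally_proximal act"
proof -
  let ?f = "\<lambda>n. (t n, xn n, x'n n)"
  obtain D' le' and g :: "('t \<times> 'x \<times> 'x) set \<Rightarrow> 't \<times> 'x \<times> 'x"
    where D': "directed_set D' le'"
      and le: "filtermap g (net_filter D' le') \<le> filtermap ?f (net_filter D le)"
    by (rule net_reindex[OF D])
  have lim: "((\<lambda>n. h (g n)) \<longlongrightarrow> l) (net_filter D' le')"
    if "((\<lambda>n. h (?f n)) \<longlongrightarrow> l) (net_filter D le)" for h :: "'t \<times> 'x \<times> 'x \<Rightarrow> 'x" and l
    using tendsto_mono[OF le, of h l] that by (simp add: filterlim_filtermap)
  have "((\<lambda>n. fst (snd (g n))) \<longlongrightarrow> x) (net_filter D' le')"
    by (rule lim) (use x in simp)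
  moreover have "((\<lambda>n. snd (snd (g n))) \<longlongrightarrow> x') (net_filter D' le')"
    by (rule lim) (use x' in simp)
  moreover have "((\<lambda>n. act (fst (g n)) (fst (snd (g n)))) \<longlongrightarrow> z) (net_filter D' le')"
    by (rule lim) (use z in simp)
  moreover have "((\<lambda>n. act (fst (g n)) (snd (snd (g n)))) \<longlongrightarrow> z) (net_filter D' le')"
    by (rule lim) (use z' in simp)
  ultimately show ?thesis
    using D' unfolding regionally_proximal_def mem_Collect_eq case_prod_conv by (intro exI conjI)
qed

end

theory Submission
  imports Defs
begin

text \<open>The nets in the definition of almost automorphy collapse to a neighbourhood condition: for
  every \<open>y\<close> and every neighbourhood \<open>U\<close> of \<open>x\<close>, if \<open>t x\<close> is close enough to \<open>y\<close> then
  \<open>t\<^sup>-\<^sup>1 y \<in> U\<close>.  From this one gets a uniform version: for every closed neighbourhood \<open>C\<close> of \<open>x\<close>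
  there is a neighbourhood \<open>W\<close> of \<open>x\<close> such that \<open>a x, a w \<in> W\<close> implies \<open>w \<in> C\<close>.  Otherwise there
  are \<open>a\<^sub>n, h\<^sub>n\<close> with \<open>h\<^sub>n x \<notin> C\<close> and with \<open>a\<^sub>n x\<close> and \<open>b\<^sub>n x = a\<^sub>n h\<^sub>n x\<close> as close to \<open>x\<close> as we
  like, depending on the earlier choices.  Put \<open>t\<^sub>n = b\<^sub>1 \<dots> b\<^bsub>n-1\<^esub> a\<^sub>n\<close>.  Then
  \<open>t\<^sub>j\<^sup>-\<^sup>1 t\<^sub>n x\<close> is so close to \<open>h\<^sub>j x\<close> that it stays outside \<open>C\<close> for all \<open>n > j\<close>, so a cluster
  point \<open>y\<close> of \<open>t\<^sub>n x\<close> satisfies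
  \<open>t\<^sub>j\<^sup>-\<^sup>1 y \<notin> interior C\<close> for all \<open>j\<close>, against the neighbourhood condition.  Three applications of
  the uniform version show that no \<open>x' \<noteq> x\<close> is regionally proximal to \<open>x\<close>.  The converse direction
  takes the constant net \<open>x\<close> as one of the two nets in the definition of \<open>Q\<close>.\<close>

lemma eventually_net_filter_ex:
  assumes "directed_set D le" "eventually P (net_filter D le)"
  shows "\<exists>i\<in>D. P i"
  using assms(2) directed_setD(2)[OF assms(1)] unfolding eventually_net_filter[OF assms(1)] by blast

lemma compact_t2_closed_nhds:
  fixes x :: "'x::t2_space"
  assumes comp: "compact (UNIV :: 'x set)" and U: "open U" "x \<in> U"
  shows "\<exists>C. closed C \<and> x \<in> interior C \<and> C \<subseteq> U"
proof -
  have "Hausdorff_space (euclidean :: 'x topology)"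
    unfolding Hausdorff_space_def disjnt_def open_openin[symmetric] by (metis hausdorff)
  then have "regular_space (euclidean :: 'x topology)"
    using comp by (intro compact_Hausdorff_imp_regular_space) (simp_all add: compact_space_def)
  moreover have "closedin euclidean (- U) \<and> x \<in> topspace euclidean - (- U)"
    using U by (simp add: closed_Compl)
  ultimately have "\<exists>A B. open A \<and> open B \<and> x \<in> A \<and> - U \<subseteq> B \<and> disjnt A B"
    by (simp add: regular_space_def)
  then obtain A B where AB: "open A" "open B" "x \<in> A" "- U \<subseteq> B" "A \<inter> B = {}"
    by (auto simp: disjnt_def)
  have "A \<subseteq> interior (- B)" using AB by (intro interior_maximal) auto
  then show ?thesis using AB by (intro exI[of _ "- B"]) auto
qed

lemma compact_sequence_cluster_point:
  fixes z :: "nat \<Rightarrow> 'x::topological_space"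
  assumes "compact (UNIV :: 'x set)"
  shows "\<exists>y. \<forall>V. open V \<longrightarrow> y \<in> V \<longrightarrow> (\<exists>\<^sub>F n in sequentially. z n \<in> V)"
proof (rule ccontr)
  assume "\<nexists>y. \<forall>V. open V \<longrightarrow> y \<in> V \<longrightarrow> (\<exists>\<^sub>F n in sequentially. z n \<in> V)"
  then have "\<forall>y. \<exists>V. open V \<and> y \<in> V \<and> (\<forall>\<^sub>F n in sequentially. z n \<notin> V)"
    by (simp add: not_frequently)
  then obtain V where V: "open (V y)" "y \<in> V y" "\<forall>\<^sub>F n in sequentially. z n \<notin> V y" for y
    by metis
  obtain F where F: "finite F" "UNIV \<subseteq> (\<Union>y\<in>F. V y)"
    by (rule compactE_image[OF assms, of UNIV V]) (use V in auto)
  have "\<forall>\<^sub>F n in sequentially. \<forall>y\<in>F. z n \<notin> V y"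
    using F(1) V(3) by (simp add: eventually_ball_finite_distrib)
  then have "\<forall>\<^sub>F n in sequentially. False"
    by eventually_elim (use F(2) in blast)
  then show False by simp
qed

lemma flow_inverse:
  assumes "flow act"
  obtains s where "\<And>x. act s (act t x) = x" "\<And>x. act t (act s x) = x"
  using assms unfolding flow_def semiflow_def by metis

lemma flow_continuous:
  assumes "flow act"
  shows "continuous_on UNIV (act t)"
proof -
  have "continuous_on UNIV (\<lambda>(t, x). act t x)"
    using assms by (simp add: flow_def semiflow_def)
  then show ?thesis
    by (rule continuous_on_compose2[where f = "Pair t" and g = "\<lambda>(t, x). act t x", simplified])
      (auto intro: continuous_intros)
qed

lemma flow_open_vimage:
  assumes "flow act" "open U"
  shows "open {x. act t x \<in> U}"
  using open_vimage[OF assms(2) flow_continuous[OF assms(1)], of t] by (simp add: vimage_def)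

lemma dense_orbit_meets_open:
  assumes "closure (orbit act x) = UNIV" "open U" "U \<noteq> {}"
  obtains t where "act t x \<in> U"
  using open_Int_closure_eq_empty[OF assms(2), of "orbit act x"] assms(1,3)
  by (auto simp: orbit_def)

text \<open>Around each \<open>x'\<close> different from \<open>x\<close> some \<open>V\<close>,
  \<open>N\<close> must exclude \<open>act t x\<close> in \<open>V\<close>,
  \<open>act t w = y\<close>, \<open>w\<close> in \<open>N\<close>: otherwise one counterexample per
  pair \<open>(V, N)\<close>, ordered by reverse inclusion, gives nets that force
  \<open>x = x'\<close>. Compactness then makes \<open>V\<close> independent of
  \<open>x'\<close>.\<close>

lemma almost_automorphic_nhds:
  fixes act :: "'t \<Rightarrow> 'x::topological_space \<Rightarrow> 'x"
  assumes comp: "compact (UNIV :: 'x set)" and x: "x \<in> almost_automorphic_points act"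
    and U: "open U" "x \<in> U"
  shows "\<exists>V. open V \<and> y \<in> V \<and> (\<forall>t w. act t x \<in> V \<longrightarrow> act t w = y \<longrightarrow> w \<in> U)"
proof -
  define sep where "sep x' V N \<longleftrightarrow> open V \<and> y \<in> V \<and> open N \<and> x' \<in> N \<and>
      (\<forall>t w. act t x \<in> V \<longrightarrow> act t w = y \<longrightarrow> w \<notin> N)" for x' V N
  have "\<exists>V N. sep x' V N" if "x' \<noteq> x" for x'
  proof (rule ccontr)
    define D where "D = {(V, N). open V \<and> y \<in> V \<and> open N \<and> x' \<in> N}"
    define le :: "'x set \<times> 'x set \<Rightarrow> 'x set \<times> 'x set \<Rightarrow> bool"
      where "le i j \<longleftrightarrow> fst j \<subseteq> fst i \<and> snd j \<subseteq> snd i" for i j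
    assume "\<not> ?thesis"
    then have "\<forall>i. \<exists>t w. i \<in> D \<longrightarrow> act t x \<in> fst i \<and> act t w = y \<and> w \<in> snd i"
      unfolding D_def sep_def by fastforce
    then obtain t w
      where tw: "i \<in> D \<Longrightarrow> act (t i) x \<in> fst i \<and> act (t i) (w i) = y \<and> w i \<in> snd i" for i
      by metis
    have dir: "directed_set D le"
      unfolding directed_set_def
    proof (intro conjI ballI)
      show "D \<noteq> {}" unfolding D_def by auto
      fix i j assume "i \<in> D" "j \<in> D"
      then show "\<exists>k\<in>D. le i k \<and> le j k"
        by (intro bexI[of _ "(fst i \<inter> fst j, snd i \<inter> snd j)"]) (auto simp: D_def le_def)
    qed (auto simp: le_def)
    have "((\<lambda>i. act (t i) x) \<longlongrightarrow> y) (net_filter D le)"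
      unfolding tendsto_net_filter_iff[OF dir]
    proof (intro allI impI)
      fix V assume "open V" "y \<in> V"
      then show "\<exists>i\<in>D. \<forall>j\<in>D. le i j \<longrightarrow> act (t j) x \<in> V"
        using tw by (intro bexI[of _ "(V, UNIV)"]) (auto simp: le_def D_def)
    qed
    moreover have "(w \<longlongrightarrow> x') (net_filter D le)"
      unfolding tendsto_net_filter_iff[OF dir]
    proof (intro allI impI)
      fix V assume "open V" "x' \<in> V"
      then show "\<exists>i\<in>D. \<forall>j\<in>D. le i j \<longrightarrow> w j \<in> V"
        using tw by (intro bexI[of _ "(UNIV, V)"]) (auto simp: le_def D_def)
    qed
    ultimately have "x = x'"
      using tw by (intro almost_automorphic_pointsD[OF x dir]) auto
    with that show False by simp
  qed
  then obtain V N where "sep x' (V x') (N x')" if "x' \<noteq> x" for x'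
    by metis
  then have VN: "open (V x')" "y \<in> V x'" "open (N x')" "x' \<in> N x'"
      "act t x \<in> V x' \<Longrightarrow> act t w = y \<Longrightarrow> w \<notin> N x'" if "x' \<noteq> x" for x' t w
    using that unfolding sep_def by blast+
  have "compact (- U)"
    using closed_Int_compact[OF _ comp, of "- U"] U by (simp add: closed_Compl)
  then obtain F where F: "F \<subseteq> - U" "finite F" "- U \<subseteq> (\<Union>x'\<in>F. N x')"
  proof (rule compactE_image)
    show "open (N x')" if "x' \<in> - U" for x'
      using VN(3)[of x'] U(2) that by auto
    show "- U \<subseteq> (\<Union>x'\<in>- U. N x')"
    proof
      fix x' assume "x' \<in> - U"
      then show "x' \<in> (\<Union>x'\<in>- U. N x')"
        using VN(4)[of x'] U(2) by auto
    qed
  qed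
  have Fx: "x' \<noteq> x" if "x' \<in> F" for x'
    using F(1) U(2) that by auto
  show ?thesis
  proof (intro exI[of _ "\<Inter>x'\<in>F. V x'"] conjI allI impI)
    show "open (\<Inter>x'\<in>F. V x')" using F(2) VN(1) Fx by blast
    show "y \<in> (\<Inter>x'\<in>F. V x')" using VN(2) Fx by blast
    fix t w assume "act t x \<in> (\<Inter>x'\<in>F. V x')" "act t w = y"
    then have "w \<notin> N x'" if "x' \<in> F" for x'
      using VN(5)[OF Fx[OF that]] that by blast
    then show "w \<in> U" using F(3) by blast
  qed
qed

lemma almost_automorphic_uniform:
  fixes act :: "'t::topological_monoid_mult \<Rightarrow> 'x::topological_space \<Rightarrow> 'x"
  assumes comp: "compact (UNIV :: 'x set)" and flow: "flow act"
    and x: "x \<in> almost_automorphic_points act" and dense: "closure (orbit act x) = UNIV"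
    and C: "closed C" "x \<in> interior C"
  shows "\<exists>W. open W \<and> x \<in> W \<and> (\<forall>a w. act a x \<in> W \<longrightarrow> act a w \<in> W \<longrightarrow> w \<in> C)"
proof (rule ccontr)
  assume neg: "\<not> ?thesis"
  have mult: "act t (act s w) = act (t * s) w" for t s w
    using flow by (simp add: flow_def semiflow_def)
  have bad: "\<exists>a h. act a x \<in> W \<and> act (a * h) x \<in> W \<and> act h x \<notin> C" if W: "open W" "x \<in> W" for W
  proof -
    obtain a w where aw: "act a x \<in> W" "act a w \<in> W" "w \<notin> C"
      using neg W by blast
    \<comment> \<open>The bad points \<open>w\<close> form an open set, so \<open>w\<close> can be
      taken on the orbit of \<open>x\<close>. This turns it into a group element \<open>h\<close>,
      which can be multiplied into the products below.\<close>
    have "open ({v. act a v \<in> W} \<inter> - C)"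
      using flow_open_vimage[OF flow W(1)] C(1) by blast
    then obtain h where "act h x \<in> {v. act a v \<in> W} \<inter> - C"
      by (rule dense_orbit_meets_open[OF dense]) (use aw in blast)
    then show ?thesis using aw(1) by (auto simp: mult)
  qed
  \<comment> \<open>The state is \<open>(p, S, t)\<close> with \<open>p = b\<^sub>1 \<dots> b\<^sub>n\<close>, \<open>S\<close> the set of inverses of the \<open>t\<^sub>j\<close> chosen
    so far and \<open>t = t\<^sub>n\<close>.\<close>
  define P where "P = (\<lambda>(n::nat) (p, S, t::'t). finite S \<and> (\<forall>s\<in>S. act (s * p) x \<notin> C))"
  define R where "R = (\<lambda>(n::nat) (p::'t, S, t::'t) (p'::'t, S', t').
    S \<subseteq> S' \<and> (\<exists>s\<in>S'. \<forall>w. act s (act t' w) = w) \<and> (\<forall>s\<in>S. act (s * t') x \<notin> C))"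
  have "\<exists>f. \<forall>n. P n (f n) \<and> R n (f n) (f (Suc n))"
  proof (rule dependent_nat_choice)
    show "\<exists>f. P 0 f" by (intro exI[of _ "(1, {}, 1)"]) (simp add: P_def)
    fix f n assume Pf: "P n f"
    obtain p S t where f: "f = (p, S, t)" by (cases f)
    \<comment> \<open>By the invariant \<open>P\<close> this finite intersection of open sets
      contains \<open>x\<close>. For the old \<open>s\<close>, \<open>act a x\<close> in
      \<open>W\<close> gives the condition in \<open>R\<close>, and \<open>act (a * h) x\<close> in
      \<open>W\<close> preserves \<open>P\<close>.\<close>
    define W where "W = (\<Inter>s\<in>S. {w. act (s * p) w \<in> - C})"
    have "open W" "x \<in> W"
      using Pf C(1) flow_open_vimage[OF flow, of "- C"] unfolding W_def f P_def by auto
    then obtain a h where ah: "act a x \<in> W" "act (a * h) x \<in> W" "act h x \<notin> C"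
      using bad by blast
    obtain s where s: "\<And>w. act s (act (p * a) w) = w"
      using flow_inverse[OF flow] by metis
    \<comment> \<open>For the new \<open>s\<close>, which undoes \<open>p * a\<close>, the invariant
      reduces to \<open>act h x\<close> lying outside \<open>C\<close>.\<close>
    have "P (Suc n) (p * (a * h), insert s S, p * a)"
      using Pf ah s unfolding P_def f W_def by (auto simp: mult[symmetric])
    moreover have "R n f (p * (a * h), insert s S, p * a)"
      using ah s unfolding R_def f W_def by (auto simp: mult[symmetric])
    ultimately show "\<exists>f'. P (Suc n) f' \<and> R n f f'" by blast
  qed
  then obtain f where f: "P n (f n)" "R n (f n) (f (Suc n))" for n by blast
  define S where "S n = fst (snd (f n))" for n
  \<comment> \<open>The third entry of \<open>f 0\<close> is only a placeholder, hence the
    shift.\<close>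
  define t where "t n = snd (snd (f (Suc n)))" for n
  have R: "S n \<subseteq> S (Suc n)" "\<exists>s\<in>S (Suc n). \<forall>w. act s (act (t n) w) = w"
      "\<forall>s\<in>S n. act (s * t n) x \<notin> C" for n
    using f(2)[of n] unfolding R_def S_def t_def by (auto split: prod.splits)
  have mono: "S m \<subseteq> S n" if "m \<le> n" for m n
    using that R(1) by (rule lift_Suc_mono_le[rotated])
  obtain y where y: "\<exists>\<^sub>F n in sequentially. act (t n) x \<in> V" if "open V" "y \<in> V" for V
    using compact_sequence_cluster_point[OF comp, of "\<lambda>n. act (t n) x"] by blast
  obtain V where V: "open V" "y \<in> V" "\<And>t w. act t x \<in> V \<Longrightarrow> act t w = y \<Longrightarrow> w \<in> interior C"
    using almost_automorphic_nhds[OF comp x open_interior C(2), of y] by blast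
  obtain j where j: "act (t j) x \<in> V"
    using y[OF V(1,2)] frequently_ex by blast
  obtain s where s: "s \<in> S (Suc j)" "\<And>w. act s (act (t j) w) = w"
    using R(2)[of j] by blast
  obtain r where r: "\<And>w. act (t j) (act r w) = w"
    using flow_inverse[OF flow] by metis
  have "act s y = act r y" using s(2)[of "act r y"] r[of y] by simp
  then have "y \<in> {v. act s v \<in> interior C}" using V(3)[OF j r[of y]] by simp
  then have "\<exists>\<^sub>F n in sequentially. act (t n) x \<in> {v. act s v \<in> interior C}"
    by (intro y flow_open_vimage[OF flow open_interior])
  \<comment> \<open>The cluster point is used a second time, now at a late index: \<open>s\<close>
    is known to belong to \<open>S n\<close> only from \<open>Suc j\<close> on.\<close>
  then obtain n where n: "n \<ge> Suc j" "act s (act (t n) x) \<in> interior C"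
    unfolding frequently_sequentially by blast
  have "act (s * t n) x \<notin> C" using R(3)[of n] mono[OF n(1)] s(1) by blast
  with n(2) interior_subset show False unfolding mult by blast
qed

lemma regionally_proximal_refl: "(x, x) \<in> regionally_proximal act"
proof -
  have "directed_set (UNIV :: unit set) (\<lambda>_ _. True)" by (simp add: directed_set_def)
  then show ?thesis
    by (rule regionally_proximalI[where xn = "\<lambda>_. x" and x'n = "\<lambda>_. x" and t = "\<lambda>_. t"]) auto
qed

text \<open>The common limit \<open>z\<close> may lie anywhere, but by minimality some
  \<open>s\<close> moves it into \<open>W\<close>; then \<open>s * t n\<close> works for a late
  \<open>n\<close>.\<close>

lemma regionally_proximal_meet:
  fixes act :: "'t::topological_monoid_mult \<Rightarrow> 'x::topological_space \<Rightarrow> 'x"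
  assumes flow: "flow act" and min: "minimal act" and Q: "(x, x') \<in> regionally_proximal act"
    and U: "open U" "x \<in> U" and U': "open U'" "x' \<in> U'" and W: "open W" "W \<noteq> {}"
  shows "\<exists>t. \<exists>u\<in>U. \<exists>u'\<in>U'. act t u \<in> W \<and> act t u' \<in> W"
proof -
  obtain D :: "('t \<times> 'x \<times> 'x) set set" and le t xn x'n z where D: "directed_set D le"
    and lim: "(xn \<longlongrightarrow> x) (net_filter D le)" "(x'n \<longlongrightarrow> x') (net_filter D le)"
      "((\<lambda>n. act (t n) (xn n)) \<longlongrightarrow> z) (net_filter D le)"
      "((\<lambda>n. act (t n) (x'n n)) \<longlongrightarrow> z) (net_filter D le)"
    using Q unfolding regionally_proximal_def by blast
  have "closure (orbit act z) = UNIV" using min by (simp add: minimal_def)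
  then obtain s where s: "act s z \<in> W" by (rule dense_orbit_meets_open[OF _ W])
  have O: "open {v. act s v \<in> W}" by (rule flow_open_vimage[OF flow W(1)])
  have "\<forall>\<^sub>F n in net_filter D le. xn n \<in> U \<and> x'n n \<in> U'
      \<and> act s (act (t n) (xn n)) \<in> W \<and> act s (act (t n) (x'n n)) \<in> W"
    using topological_tendstoD[OF lim(1) U] topological_tendstoD[OF lim(2) U']
      topological_tendstoD[OF lim(3) O] topological_tendstoD[OF lim(4) O] s
    by (simp add: eventually_conj)
  then obtain n where "xn n \<in> U" "x'n n \<in> U'"
      "act s (act (t n) (xn n)) \<in> W" "act s (act (t n) (x'n n)) \<in> W"
    using eventually_net_filter_ex[OF D] by blast
  then show ?thesis using flow unfolding flow_def semiflow_def by metis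
qed

lemma almost_automorphic_regionally_proximal:
  fixes act :: "'t::topological_monoid_mult \<Rightarrow> 'x::t2_space \<Rightarrow> 'x"
  assumes comp: "compact (UNIV :: 'x set)" and flow: "flow act" and min: "minimal act"
    and x: "x \<in> almost_automorphic_points act" and Q: "(x, x') \<in> regionally_proximal act"
  shows "x' = x"
proof (rule ccontr)
  assume "x' \<noteq> x"
  have dense: "closure (orbit act x) = UNIV" using min by (simp add: minimal_def)
  have mult: "act t (act s w) = act (t * s) w" for t s w
    using flow by (simp add: flow_def semiflow_def)
  note unif = almost_automorphic_uniform[OF comp flow x dense]
  obtain C where C: "closed C" "x \<in> interior C" "x' \<notin> C"
    using compact_t2_closed_nhds[OF comp, of "- {x'}" x] \<open>x' \<noteq> x\<close> by auto
  obtain W where W: "open W" "x \<in> W" "\<And>a w. act a x \<in> W \<Longrightarrow> act a w \<in> W \<Longrightarrow> w \<in> C"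
    using unif[OF C(1,2)] by blast
  obtain C' where C': "closed C'" "x \<in> interior C'" "C' \<subseteq> W"
    using compact_t2_closed_nhds[OF comp W(1,2)] by blast
  obtain W' where W': "open W'" "x \<in> W'" "\<And>a w. act a x \<in> W' \<Longrightarrow> act a w \<in> W' \<Longrightarrow> w \<in> C'"
    using unif[OF C'(1,2)] by blast
  obtain t u w where t: "u \<in> W'" "w \<in> - C" "act t u \<in> W'" "act t w \<in> W'"
    using regionally_proximal_meet[OF flow min Q W'(1,2) _ _ W'(1), of "- C"] C(1,3) W'(2) by blast
  \<comment> \<open>This open set contains \<open>u\<close>, so \<open>u\<close> can be replaced by
    an orbit point \<open>act g x\<close>.\<close>
  have "open (W' \<inter> {v. act t v \<in> W'})"
    using W'(1) flow_open_vimage[OF flow W'(1)] by blast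
  then obtain g where g: "act g x \<in> W'" "act t (act g x) \<in> W'"
    by (rule dense_orbit_meets_open[OF dense]) (use t in blast)+
  obtain r where r: "\<And>v. act r (act g v) = v" "\<And>v. act g (act r v) = v"
    using flow_inverse[OF flow] by metis
  \<comment> \<open>The uniform version is used with \<open>a = g\<close>, then with
    \<open>a = t * g\<close>, to bring \<open>act r x\<close> and \<open>act r w\<close> into
    \<open>W\<close>. A third use, with \<open>a = r\<close>, puts \<open>w\<close> into
    \<open>C\<close>.\<close>
  have "act r x \<in> W" using W'(3)[OF g(1), of "act r x"] W'(2) C'(3) r(2) by auto
  moreover have "act r w \<in> W"
  proof -
    have "act (t * g) (act r w) = act t w" by (simp add: mult[symmetric] r)
    then show ?thesis using W'(3)[of "t * g" "act r w"] g(2) t(4) C'(3) by (auto simp: mult)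
  qed
  ultimately show False using W(3) t(2) by blast
qed

theorem theorem0p14:
  fixes act :: "'t::topological_monoid_mult \<Rightarrow> 'x::t2_space \<Rightarrow> 'x"
  assumes "compact (UNIV :: 'x set)"
    and "flow act"
    and "minimal act"
  shows "aa_flow act \<longleftrightarrow> (\<exists>x. regionally_proximal act `` {x} = {x})"
proof
  assume "aa_flow act"
  then obtain x where "x \<in> almost_automorphic_points act" by (auto simp: aa_flow_def)
  then have "regionally_proximal act `` {x} = {x}"
    using almost_automorphic_regionally_proximal[OF assms] regionally_proximal_refl[of x act] by blast
  then show "\<exists>x. regionally_proximal act `` {x} = {x}" ..
next
  assume "\<exists>x. regionally_proximal act `` {x} = {x}"
  then obtain x where x: "regionally_proximal act `` {x} = {x}" ..
  have "x \<in> almost_automorphic_points act"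
    unfolding almost_automorphic_points_def
  proof (intro CollectI allI impI)
    fix D :: "('t \<times> 'x) set set" and le t x'n x' y
    assume D: "directed_set D le" and y: "((\<lambda>n. act (t n) x) \<longlongrightarrow> y) (net_filter D le)"
      and x': "(x'n \<longlongrightarrow> x') (net_filter D le)" and eq: "\<forall>n\<in>D. act (t n) (x'n n) = y"
    have "\<forall>\<^sub>F n in net_filter D le. act (t n) (x'n n) = y"
      using eq directed_setD(1)[OF D] by (auto simp: eventually_net_filter[OF D])
    then have "((\<lambda>n. act (t n) (x'n n)) \<longlongrightarrow> y) (net_filter D le)"
      by (rule tendsto_eventually)
    then have "(x, x') \<in> regionally_proximal act"
      by (rule regionally_proximalI[where act = act and t = t and xn = "\<lambda>_. x", OF D tendsto_const x' y])
    with x show "x = x'" by auto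
  qed
  then show "aa_flow act"
    using assms(2,3) unfolding aa_flow_def minimal_def by blast
qed

end
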